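(* Let $k\ge 1$ be an integer and define $f:\mathbb{N}^k\to\mathbb{Z}$ by \[f(n_1,\dots,n_k)=\sum_{d_1\mid n_1,\dots,d_k\mid n_k}\mu(n_1/d_1)\cdots\mu(n_k/d_k)\,\frac{d_1\cdots d_k}{[d_1,\dots,d_k]}.\] Then $f(n_1,\dots,n_k)\ge 0$ for all $(n_1,\dots,n_k)\in\mathbb{N}^k$.
   Context: $\mu$ is the Möbius function and $[d_1,\dots,d_k]$ denotes the least common multiple. *)

theory Defs
  imports "HOL-Computational_Algebra.Computational_Algebra" "HOL-Library.FuncSet"
begin

definition moebius :: "nat \<Rightarrow> int" where
  "moebius n = (if squarefree n then (-1) ^ card (prime_factors n) else 0)"

text \<open>
  A tuple \<open>(n\<^sub>1, \<dots>, n\<^sub>k)\<close> is a function \<open>n :: nat \<Rightarrow> nat\<close> of which only the values on \<open>{1..k}\<close>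
  matter; the divisor tuples are taken extensional outside \<open>{1..k}\<close>, so that each is counted once.
  The definition is meaningful when all \<open>n\<^sub>i\<close> are positive: there are then finitely many divisor
  tuples, and both uses of \<open>div\<close> are exact, the second one by \<open>Lcm_dvd_prod\<close> below.
\<close>

definition f :: "nat \<Rightarrow> (nat \<Rightarrow> nat) \<Rightarrow> int" where
  "f k n = (\<Sum>d \<in> (\<Pi>\<^sub>E i\<in>{1..k}. {e. e dvd n i}).
     (\<Prod>i=1..k. moebius (n i div d i)) * int ((\<Prod>i=1..k. d i) div (LCM i\<in>{1..k}. d i)))"

lemma Lcm_dvd_prod: "(LCM i\<in>{1..k}. d i) dvd (\<Prod>i=1..k. d i)" for d :: "nat \<Rightarrow> nat"
  by (rule Lcm_least) (auto intro: dvd_prodI)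

lemma finite_divisor_tuples:
  fixes n :: "nat \<Rightarrow> nat"
  assumes "\<And>i. i \<in> {1..k} \<Longrightarrow> n i > 0"
  shows "finite (\<Pi>\<^sub>E i\<in>{1..k}. {e. e dvd n i})"
  using assms by (intro finite_PiE) auto

end

(*
  For positive d_i, d_1...d_k / [d_1,...,d_k] is the number of tuples in (Q/Z)^k with
  d_i x_i = 0 for all i and x_1 + ... + x_k = 0: it is the order of the kernel of the sum map from
  the product of the d_i-torsion groups onto the [d_1,...,d_k]-torsion group.  Moebius inversion in
  each coordinate turns the condition d_i x_i = 0 into "x_i has order exactly n_i", so f counts the
  tuples of elements of orders n_1, ..., n_k with sum zero, and is therefore nonnegative.
  Q/Z is replaced by Z/NZ, where N is the product of the n_i and residues are integers in {0..<N};
  x has order N / gcd N x there.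
*)

theory Submission
  imports Defs
begin

section \<open>Moebius inversion over the divisors of a natural number\<close>

lemma moebius_prime_mult:
  assumes "prime p" "\<not> p dvd d" "squarefree d"
  shows "moebius (p * d) = - moebius d"
proof -
  have d: "d \<noteq> 0" and p: "p \<noteq> 0" using assms by (auto intro: Nat.gr0I)
  have cop: "coprime p d" using assms by (simp add: prime_imp_coprime)
  have "squarefree (p * d)" using assms cop
    by (simp add: squarefree_mult_coprime squarefree_prime)
  moreover have "prime_factors (p * d) = insert p (prime_factors d)"
    using assms d p by (simp add: prime_factors_product prime_prime_factors)
  moreover have "p \<notin> prime_factors d" using assms by auto
  ultimately show ?thesis using assms by (simp add: moebius_def)
qed

text \<open>For a prime \<open>p\<close> dividing \<open>n\<close>, the squarefree divisors of
  \<open>n\<close> fall into those prime to \<open>p\<close> (the set \<open>C\<close>) and their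
  products with \<open>p\<close>. Multiplication by \<open>p\<close> flips the sign of
  \<open>moebius\<close>, so the two halves cancel.\<close>

lemma sum_moebius_divisors:
  fixes n :: nat
  assumes "n > 0"
  shows "(\<Sum>d | d dvd n. moebius d) = of_bool (n = 1)"
proof (cases "n = 1")
  case True
  then show ?thesis by (simp add: moebius_def)
next
  case False
  then obtain p where p: "prime p" "p dvd n" by (metis prime_factor_nat)
  define C where "C = {d. d dvd n \<and> squarefree d \<and> \<not> p dvd d}"
  have fin: "finite {d. d dvd n}" using assms by simp
  have finC: "finite C" unfolding C_def by (rule finite_subset[OF _ fin]) auto
  have split: "{d. d dvd n \<and> squarefree d} = C \<union> (*) p ` C"
  proof (intro equalityI subsetI)
    fix d assume d: "d \<in> {d. d dvd n \<and> squarefree d}"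
    show "d \<in> C \<union> (*) p ` C"
    proof (cases "p dvd d")
      case True
      then obtain e where e: "d = p * e" by blast
      have "\<not> p dvd e"
      proof
        assume "p dvd e"
        then have "p ^ 2 dvd d" using e by (simp add: power2_eq_square)
        then have "is_unit p" using d by (auto simp: squarefree_def)
        then show False using p by simp
      qed
      moreover have "squarefree e" using d e squarefree_multD(2)[of p e] by simp
      moreover have "e dvd n" using d e by (auto dest: dvd_mult_right)
      ultimately show ?thesis using e by (auto simp: C_def)
    qed (use d in \<open>auto simp: C_def\<close>)
  next
    fix d assume "d \<in> C \<union> (*) p ` C"
    then consider "d \<in> C" | e where "e \<in> C" "d = p * e" by blast
    then show "d \<in> {d. d dvd n \<and> squarefree d}"
    proof cases
      case 2
      then have "coprime p e" using p by (simp add: C_def prime_imp_coprime)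
      then show ?thesis using 2 p
        by (simp add: C_def divides_mult squarefree_mult_coprime squarefree_prime)
    qed (simp add: C_def)
  qed
  have "(\<Sum>d | d dvd n. moebius d) = sum moebius {d. d dvd n \<and> squarefree d}"
    by (rule sum.mono_neutral_right[OF fin]) (auto simp: moebius_def)
  also have "\<dots> = sum moebius C + sum moebius ((*) p ` C)"
    unfolding split by (rule sum.union_disjoint) (use finC in \<open>auto simp: C_def\<close>)
  also have "sum moebius ((*) p ` C) = (\<Sum>d\<in>C. moebius (p * d))"
    using p by (subst sum.reindex) (auto simp: inj_on_def prime_gt_0_nat)
  also have "\<dots> = (\<Sum>d\<in>C. - moebius d)"
    by (rule sum.cong) (use p in \<open>auto simp: C_def moebius_prime_mult\<close>)
  finally show ?thesis using False by (simp add: sum_negf)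
qed

text \<open>This is the inversion used in each coordinate: with \<open>m\<close> the order of an
  element, it turns "order divides \<open>d\<close>" into "order equals \<open>n\<close>". Writing
  \<open>n = m * q\<close>, the substitution \<open>e = n div d\<close> runs over the divisors of
  \<open>q\<close>, which reduces the sum to \<open>sum_moebius_divisors\<close>.\<close>

lemma sum_moebius_multiples:
  fixes m n :: nat
  assumes "n > 0"
  shows "(\<Sum>d | d dvd n. moebius (n div d) * of_bool (m dvd d)) = of_bool (m = n)"
proof (cases "m dvd n")
  case False
  then show ?thesis by (auto intro!: sum.neutral dest: dvd_trans)
next
  case True
  then obtain q where q: "n = m * q" by blast
  have pos: "m > 0" "q > 0" using assms q by auto
  have "(\<Sum>d | d dvd n. moebius (n div d) * of_bool (m dvd d))
      = (\<Sum>d | d dvd n \<and> m dvd d. moebius (n div d))"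
    by (rule sum.mono_neutral_cong_right) (use assms in auto)
  also have "\<dots> = (\<Sum>e | e dvd q. moebius e)"
    by (rule sum.reindex_bij_witness[of _ "\<lambda>e. m * (q div e)" "\<lambda>d. n div d"])
       (use pos q in \<open>auto elim!: dvdE\<close>)
  also have "\<dots> = of_bool (m = n)" using sum_moebius_divisors[OF pos(2)] pos q by auto
  finally show ?thesis .
qed

section \<open>Torsion elements of Z/NZ and tuples of them with prescribed sum\<close>

text \<open>The quotient on the right is the order of \<open>x\<close> in Z/NZ. Dividing both sides
  by the gcd leaves coprime cofactors, so the one of \<open>N\<close> must divide
  \<open>d\<close>.\<close>

lemma dvd_mult_iff_div_gcd_dvd:
  fixes N :: nat and x :: int
  assumes "N > 0"
  shows "int N dvd int d * x \<longleftrightarrow> N div gcd N (nat \<bar>x\<bar>) dvd d"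
proof -
  define y where "y = nat \<bar>x\<bar>"
  define h where "h = gcd N y"
  have h: "h > 0" using assms by (simp add: h_def)
  have N: "N = (N div h) * h" and y: "y = (y div h) * h" by (simp_all add: h_def)
  have cop: "coprime (N div h) (y div h)"
    unfolding h_def using assms by (intro div_gcd_coprime) auto
  have "int N dvd int d * x \<longleftrightarrow> N dvd d * y"
    by (metis y_def abs_mult abs_of_nat dvd_abs_iff int_dvd_int_iff of_nat_mult nat_0_le
        abs_ge_zero)
  also have "\<dots> \<longleftrightarrow> (N div h) * h dvd (d * (y div h)) * h"
    using N y by (metis mult.assoc)
  also have "\<dots> \<longleftrightarrow> N div h dvd d * (y div h)" using h by simp
  also have "\<dots> \<longleftrightarrow> N div h dvd d" using cop by (simp add: coprime_dvd_mult_left_iff)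
  finally show ?thesis by (simp add: h_def y_def)
qed

text \<open>The residues killed by \<open>g\<close> are the multiples of \<open>q = N / g\<close>,
  one for each \<open>j\<close> in \<open>{0..<g}\<close>.\<close>

lemma card_torsion:
  fixes g N :: nat
  assumes "g dvd N" "N > 0"
  shows "card {x \<in> {0..<int N}. int N dvd int g * x} = g"
proof -
  from assms obtain q where q: "N = g * q" by blast
  have pos: "g > 0" "q > 0" using assms q by auto
  have "{x \<in> {0..<int N}. int N dvd int g * x} = (\<lambda>j. int q * j) ` {0..<int g}"
  proof (intro equalityI subsetI)
    fix x assume x: "x \<in> {x \<in> {0..<int N}. int N dvd int g * x}"
    then have "int q dvd x" using q pos by simp
    then obtain j where j: "x = int q * j" by blast
    have "0 \<le> j" using x j pos by (simp add: zero_le_mult_iff)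
    moreover have "int q * j < int q * int g" using x j q by (simp add: mult.commute)
    then have "j < int g" using pos by simp
    ultimately show "x \<in> (\<lambda>j. int q * j) ` {0..<int g}" using j by auto
  next
    fix x assume "x \<in> (\<lambda>j. int q * j) ` {0..<int g}"
    then show "x \<in> {x \<in> {0..<int N}. int N dvd int g * x}"
      using pos q by (auto simp: mult.commute)
  qed
  then show ?thesis using pos by (simp add: card_image inj_on_def)
qed

text \<open>The d-torsion meets the coset of \<open>r\<close> modulo the L-torsion exactly when
  \<open>r\<close> is a sum of a d-torsion and an L-torsion element, that is, when
  \<open>lcm d L\<close> kills \<open>r\<close>. The intersection is then a coset of the common
  torsion, which is the torsion of \<open>gcd d L\<close>.\<close>

lemma card_torsion_inter_coset:
  fixes d L N :: nat and r :: int
  assumes "d dvd N" "L dvd N" "N > 0"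
  shows "card {x \<in> {0..<int N}. int N dvd int d * x \<and> int N dvd int L * (r - x)}
       = (if int N dvd int (lcm d L) * r then gcd d L else 0)" (is "card ?S = _")
proof (cases "int N dvd int (lcm d L) * r")
  case False
  have "?S = {}"
  proof (rule equals0I)
    fix x assume x: "x \<in> ?S"
    have "int N dvd int (lcm d L) * x" using x
      by (auto intro: dvd_trans[OF _ mult_dvd_mono[OF _ dvd_refl]])
    moreover have "int N dvd int (lcm d L) * (r - x)" using x
      by (auto intro: dvd_trans[OF _ mult_dvd_mono[OF _ dvd_refl]])
    ultimately have "int N dvd int (lcm d L) * x + int (lcm d L) * (r - x)" by (rule dvd_add)
    then show False using False by (simp add: algebra_simps)
  qed
  then show ?thesis using False by (simp only: if_False card.empty)
next
  case True
  define g where "g = gcd d L"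
  have pos: "d > 0" "L > 0" "g > 0" using assms by (auto simp: g_def intro: Nat.gr0I)
  obtain d' L' where dL: "d = g * d'" "L = g * L'" by (metis g_def dvdE gcd_dvd1 gcd_dvd2)
  have "d = d' * gcd d L" "L = L' * gcd d L" using dL by (metis g_def mult.commute)+
  then have "coprime d' L'" using pos by (intro gcd_coprime[of d L]) (auto simp: g_def)
  then have "gcd (int d') (int L') = 1" by (simp add: coprime_iff_gcd_eq_1)
  then obtain u v where uv: "u * int d' + v * int L' = 1" by (metis bezout_int)
  have "d * L = g * lcm d L" unfolding g_def by (rule prod_gcd_lcm_nat)
  moreover have "d * L = g * (d * L')" "d * L = g * (L * d')"
    by (simp_all only: dL(2) dL(1) mult.assoc mult.commute mult.left_commute)
  ultimately have lcm: "lcm d L = d * L'" "lcm d L = L * d'" using pos by simp_all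
  \<comment> \<open>The Bezout identity \<open>uv\<close> splits \<open>r\<close> as
    \<open>a + u * d' * r\<close>. The first summand is killed by \<open>d\<close> and the second by
    \<open>L\<close>, so \<open>a\<close> is a point of the intersection.\<close>
  define a where "a = v * int L' * r"
  have "int d * a = v * (int (lcm d L) * r)" by (simp add: a_def lcm(1))
  with True have a1: "int N dvd int d * a" by simp
  have "r - a = (u * int d' + v * int L') * r - a" by (simp add: uv)
  also have "\<dots> = u * int d' * r" by (simp add: a_def algebra_simps)
  finally have "int L * (r - a) = u * (int (lcm d L) * r)" by (simp add: lcm(2))
  with True have a2: "int N dvd int L * (r - a)" by simp
  let ?T = "{x \<in> {0..<int N}. int N dvd int g * x}"
  \<comment> \<open>The order of \<open>x\<close> divides \<open>g\<close> iff it divides both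
    \<open>d\<close> and \<open>L\<close>.\<close>
  have T: "int N dvd int g * x \<longleftrightarrow> int N dvd int d * x \<and> int N dvd int L * x" for x
  proof -
    have "int N dvd int g * x \<longleftrightarrow> N div gcd N (nat \<bar>x\<bar>) dvd g"
      by (rule dvd_mult_iff_div_gcd_dvd[OF assms(3)])
    then show ?thesis by (simp add: g_def dvd_mult_iff_div_gcd_dvd[OF assms(3)])
  qed
  have dvd_mod: "int N dvd c * (y mod int N) \<longleftrightarrow> int N dvd c * y" for c y
    by (metis dvd_eq_mod_eq_0 mod_mult_right_eq)
  have shift: "int N dvd c * (r - y mod int N) \<longleftrightarrow> int N dvd c * (r - y)" for c y
  proof -
    have "c * (r - y mod int N) = c * (r - y) + int N * (c * (y div int N))"
      by (simp add: algebra_simps flip: minus_mult_div_eq_mod)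
    then show ?thesis by (simp add: dvd_add_left_iff)
  qed
  \<comment> \<open>Translation by \<open>a\<close> carries the g-torsion onto the intersection;
    translation by \<open>-a\<close> is its inverse.\<close>
  have "bij_betw (\<lambda>x. (x + a) mod int N) ?T ?S"
  proof (rule bij_betw_byWitness[where f' = "\<lambda>x. (x - a) mod int N"])
    show "(\<lambda>x. (x + a) mod int N) ` ?T \<subseteq> ?S"
    proof (intro image_subsetI)
      fix x assume x: "x \<in> ?T"
      have "int N dvd int d * x + int d * a" using x T a1 by (intro dvd_add) auto
      then have "int N dvd int d * (x + a)" by (simp add: distrib_left)
      moreover have "int N dvd int L * (r - a) - int L * x" using x T a2 by (intro dvd_diff) auto
      then have "int N dvd int L * (r - (x + a))" by (simp add: algebra_simps)
      ultimately show "(x + a) mod int N \<in> ?S" using assms(3) by (simp add: dvd_mod shift)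
    qed
    show "(\<lambda>x. (x - a) mod int N) ` ?S \<subseteq> ?T"
    proof (intro image_subsetI)
      fix x assume x: "x \<in> ?S"
      have "int N dvd int d * x - int d * a" using x a1 by (intro dvd_diff) auto
      then have "int N dvd int d * (x - a)" by (simp add: right_diff_distrib)
      moreover have "int N dvd int L * (r - a) - int L * (r - x)" using x a2
        by (intro dvd_diff) auto
      then have "int N dvd int L * (x - a)" by (simp add: algebra_simps)
      ultimately show "(x - a) mod int N \<in> ?T" using assms(3) by (simp add: T dvd_mod)
    qed
  qed (auto simp: mod_simps)
  then have "card ?S = card ?T" by (simp add: bij_betw_same_card)
  also have "\<dots> = g" using assms by (intro card_torsion) (auto simp: g_def)
  finally show ?thesis using True by (simp only: if_True g_def)
qed

text \<open>The sum counts the tuples in the fibre over \<open>r\<close> of the sum map on the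
  product of torsion groups. A general \<open>r\<close> is needed for the induction: fixing the
  coordinate \<open>j\<close> to be \<open>y\<close> leaves the target \<open>r - y\<close>.
  Multiplying by the lcm instead of dividing keeps the identity free of \<open>div\<close>.\<close>

lemma sum_torsion_tuples:
  fixes d :: "'a \<Rightarrow> nat" and N :: nat and r :: int
  assumes "finite I" "\<And>i. i \<in> I \<Longrightarrow> d i dvd N" "N > 0"
  shows "(\<Sum>x\<in>PiE I (\<lambda>i. {x \<in> {0..<int N}. int N dvd int (d i) * x}).
            of_bool (int N dvd r - (\<Sum>i\<in>I. x i))) * (LCM i\<in>I. d i)
       = of_bool (int N dvd int (LCM i\<in>I. d i) * r) * (\<Prod>i\<in>I. d i)"
  using assms(1,2)
proof (induction I arbitrary: r rule: finite_induct)
  case empty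
  then show ?case by simp
next
  case (insert j I)
  define S where "S = (\<lambda>i. {x \<in> {0..<int N}. int N dvd int (d i) * x})"
  define L where "L = (LCM i\<in>I. d i)"
  define P where "P = (\<Prod>i\<in>I. d i)"
  define c where "c = (\<lambda>r. \<Sum>x\<in>PiE I S. of_bool (int N dvd r - (\<Sum>i\<in>I. x i)) :: nat)"
  have IH: "c r * L = of_bool (int N dvd int L * r) * P" for r
    using insert by (simp add: c_def S_def L_def P_def)
  have "L dvd N" unfolding L_def using insert.prems by (auto intro: Lcm_least)
  have "finite (S j)" unfolding S_def by (rule finite_subset[of _ "{0..<int N}"]) auto
  \<comment> \<open>Tuples over \<open>insert j I\<close> arise by updating a tuple over
    \<open>I\<close> at \<open>j\<close>, which leaves its sum over \<open>I\<close>
    unchanged.\<close>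
  have upd: "(\<Sum>i\<in>I. if i = j then y else x i) = (\<Sum>i\<in>I. x i)" for x :: "'a \<Rightarrow> int" and y
    by (rule sum.cong) (use insert.hyps in auto)
  have "(\<Sum>x\<in>PiE (insert j I) S. of_bool (int N dvd r - (\<Sum>i\<in>insert j I. x i)) :: nat)
      = (\<Sum>(y, x)\<in>S j \<times> PiE I S. of_bool (int N dvd (r - y) - (\<Sum>i\<in>I. x i)))"
    unfolding PiE_insert_eq sum.reindex[OF inj_combinator[OF insert.hyps(2)]]
    using insert.hyps by (intro sum.cong) (auto simp: upd diff_diff_eq)
  also have "\<dots> = (\<Sum>y\<in>S j. c (r - y))" by (simp add: sum.cartesian_product c_def)
  finally have step: "(\<Sum>x\<in>PiE (insert j I) S. of_bool (int N dvd r - (\<Sum>i\<in>insert j I. x i)) :: nat)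
      = (\<Sum>y\<in>S j. c (r - y))" .
  \<comment> \<open>By the induction hypothesis each term is constant on those \<open>y\<close> for
    which \<open>L\<close> kills \<open>r - y\<close> and is zero otherwise, so only the number of
    such \<open>y\<close> in \<open>S j\<close> matters.\<close>
  have "(\<Sum>y\<in>S j. c (r - y)) * L = (\<Sum>y\<in>S j. of_bool (int N dvd int L * (r - y))) * P"
    by (simp add: sum_distrib_right IH)
  also have "(\<Sum>y\<in>S j. of_bool (int N dvd int L * (r - y)))
      = card {y \<in> {0..<int N}. int N dvd int (d j) * y \<and> int N dvd int L * (r - y)}"
  proof -
    have "S j \<inter> {y. int N dvd int L * (r - y)}
        = {y \<in> {0..<int N}. int N dvd int (d j) * y \<and> int N dvd int L * (r - y)}"
      by (auto simp: S_def)
    then show ?thesis using \<open>finite (S j)\<close> by (simp add: sum_of_bool_eq)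
  qed
  also have "\<dots> = of_bool (int N dvd int (lcm (d j) L) * r) * gcd (d j) L"
    using card_torsion_inter_coset[OF insert.prems[OF insertI1] \<open>L dvd N\<close> \<open>N > 0\<close>, of r]
    by (simp only: of_bool_def if_distrib[of "\<lambda>b. b * _"] mult_1 mult_zero_left)
  finally have sum_L: "(\<Sum>y\<in>S j. c (r - y)) * L
      = of_bool (int N dvd int (lcm (d j) L) * r) * gcd (d j) L * P" .
  \<comment> \<open>The extra factor \<open>lcm (d j) L\<close> completes the gcd to the product
    \<open>d j * L\<close>; the positive factor \<open>L\<close> is cancelled afterwards.\<close>
  have "(\<Sum>y\<in>S j. c (r - y)) * lcm (d j) L * L = (\<Sum>y\<in>S j. c (r - y)) * L * lcm (d j) L"
    by (simp only: ac_simps)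
  also have "\<dots> = of_bool (int N dvd int (lcm (d j) L) * r) * (gcd (d j) L * lcm (d j) L) * P"
    unfolding sum_L by (simp only: ac_simps)
  also have "\<dots> = of_bool (int N dvd int (lcm (d j) L) * r) * (d j * P) * L"
    unfolding prod_gcd_lcm_nat[symmetric] by (simp only: ac_simps)
  finally have "(\<Sum>y\<in>S j. c (r - y)) * lcm (d j) L * L
      = of_bool (int N dvd int (lcm (d j) L) * r) * (d j * P) * L" .
  moreover have "L > 0" using \<open>L dvd N\<close> \<open>N > 0\<close> by (auto intro: Nat.gr0I)
  ultimately have "(\<Sum>y\<in>S j. c (r - y)) * lcm (d j) L
      = of_bool (int N dvd int (lcm (d j) L) * r) * (d j * P)" by simp
  then show ?case using insert.hyps unfolding step[symmetric] by (simp add: S_def L_def P_def)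
qed

section \<open>Expansion of \<open>f\<close> as a sum over tuples of residues\<close>

theorem theorem4p1:
  fixes k :: nat and n :: "nat \<Rightarrow> nat"
  assumes "k \<ge> 1" and "\<And>i. i \<in> {1..k} \<Longrightarrow> n i > 0"
  shows "f k n \<ge> 0"
proof -
  \<comment> \<open>A common multiple of all \<open>n i\<close>, so that every \<open>d i\<close>
    divides \<open>N\<close> and Z/NZ contains all the torsion involved.\<close>
  define N where "N = (\<Prod>i=1..k. n i)"
  have "N > 0" unfolding N_def using assms(2) by (intro prod_pos) auto
  define X where "X = PiE {1..k} (\<lambda>_. {0..<int N})"
  define D where "D = PiE {1..k} (\<lambda>i. {e. e dvd n i})"
  \<comment> \<open>The conditions on \<open>x\<close> are encoded as the factors \<open>z\<close>
    and \<open>t\<close>, so that the index set \<open>X\<close> does not depend on \<open>d\<close>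
    and the sums over \<open>d\<close> and \<open>x\<close> can be exchanged.\<close>
  define z :: "(nat \<Rightarrow> int) \<Rightarrow> int" where "z = (\<lambda>x. of_bool (int N dvd (\<Sum>i=1..k. x i)))"
  define t :: "nat \<Rightarrow> int \<Rightarrow> int" where "t = (\<lambda>d x. of_bool (int N dvd int d * x))"
  have finX: "finite X" by (simp add: X_def finite_PiE)
  have quot: "int ((\<Prod>i=1..k. d i) div (LCM i\<in>{1..k}. d i))
      = (\<Sum>x\<in>X. z x * (\<Prod>i=1..k. t (d i) (x i)))" if "d \<in> D" for d
  proof -
    let ?Y = "PiE {1..k} (\<lambda>i. {x \<in> {0..<int N}. int N dvd int (d i) * x})"
    let ?L = "LCM i\<in>{1..k}. d i"
    have dvd: "d i dvd N" if "i \<in> {1..k}" for i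
    proof -
      have "d i dvd n i" using \<open>d \<in> D\<close> that by (auto simp: D_def)
      also have "n i dvd N" unfolding N_def using that by (intro dvd_prodI) auto
      finally show ?thesis .
    qed
    have "?L dvd N" using dvd by (auto intro: Lcm_least)
    then have "?L > 0" using \<open>N > 0\<close> by (auto intro: Nat.gr0I)
    \<comment> \<open>For \<open>r = 0\<close> the divisibility condition on the right of
      \<open>sum_torsion_tuples\<close> always holds.\<close>
    have eq: "(\<Sum>x\<in>?Y. of_bool (int N dvd (\<Sum>i=1..k. x i))) * ?L = (\<Prod>i=1..k. d i)"
      using sum_torsion_tuples[where I = "{1..k}" and r = 0, OF _ dvd \<open>N > 0\<close>] by simp
    have "int ((\<Prod>i=1..k. d i) div ?L) = int (\<Sum>x\<in>?Y. of_bool (int N dvd (\<Sum>i=1..k. x i)))"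
      unfolding eq[symmetric] by (subst div_mult_self_is_m[OF \<open>?L > 0\<close>]) (rule refl)
    also have "\<dots> = sum z ?Y" by (simp add: z_def)
    also have "\<dots> = (\<Sum>x\<in>X. z x * (\<Prod>i=1..k. t (d i) (x i)))"
    proof (rule sum.mono_neutral_cong_left[OF finX])
      show "?Y \<subseteq> X" unfolding X_def by (rule PiE_mono) auto
      show "\<forall>x\<in>X - ?Y. z x * (\<Prod>i=1..k. t (d i) (x i)) = 0"
      proof
        fix x assume "x \<in> X - ?Y"
        then have "\<exists>i\<in>{1..k}. t (d i) (x i) = 0" by (auto simp: X_def t_def PiE_iff)
        then have "(\<Prod>i=1..k. t (d i) (x i)) = 0" by (intro prod_zero) auto
        then show "z x * (\<Prod>i=1..k. t (d i) (x i)) = 0" by simp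
      qed
      show "z x = z x * (\<Prod>i=1..k. t (d i) (x i))" if "x \<in> ?Y" for x
      proof -
        have "(\<Prod>i=1..k. t (d i) (x i)) = 1"
          using that by (intro prod.neutral) (auto simp: t_def PiE_iff)
        then show ?thesis by simp
      qed
    qed
    finally show ?thesis .
  qed
  have "f k n = (\<Sum>d\<in>D. \<Sum>x\<in>X. z x * (\<Prod>i=1..k. moebius (n i div d i) * t (d i) (x i)))"
    unfolding f_def D_def[symmetric]
    by (rule sum.cong) (simp_all only: quot sum_distrib_left prod.distrib mult.left_commute)
  also have "\<dots> = (\<Sum>x\<in>X. z x * (\<Sum>d\<in>D. \<Prod>i=1..k. moebius (n i div d i) * t (d i) (x i)))"
    by (subst sum.swap) (simp add: sum_distrib_left)
  \<comment> \<open>For fixed \<open>x\<close> the summand is a product over coordinates, so the sum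
    over divisor tuples factors.\<close>
  also have "\<dots> = (\<Sum>x\<in>X. z x * (\<Prod>i=1..k. \<Sum>d | d dvd n i. moebius (n i div d) * t d (x i)))"
    unfolding D_def using assms(2) by (subst prod_sum_PiE) auto
  finally have f_eq: "f k n
      = (\<Sum>x\<in>X. z x * (\<Prod>i=1..k. \<Sum>d | d dvd n i. moebius (n i div d) * t d (x i)))" .
  \<comment> \<open>By Moebius inversion this sum is 1 if \<open>y\<close> has order
    \<open>n i\<close> in Z/NZ and 0 otherwise.\<close>
  have "0 \<le> (\<Sum>d | d dvd n i. moebius (n i div d) * t d y)" if "i \<in> {1..k}" for i y
    unfolding t_def dvd_mult_iff_div_gcd_dvd[OF \<open>N > 0\<close>]
    using assms(2)[OF that] by (subst sum_moebius_multiples) auto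
  then have "0 \<le> z x * (\<Prod>i=1..k. \<Sum>d | d dvd n i. moebius (n i div d) * t d (x i))" for x
    by (intro mult_nonneg_nonneg[OF _ prod_nonneg]) (simp_all add: z_def)
  then show ?thesis unfolding f_eq by (rule sum_nonneg)
qed

end
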